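(* Let $G$ be a finite group, and let $H$ and $N$ be subgroups of $G$ such that $N\unlhd G$ and $N\subseteq H$. Then for every integer $n\geq 1$, $$d_{n}^{\otimes}(H,G)\leq d_{n}^{\otimes}(H/N,\,G/N).$$
   Context: For a group $G$, the nonabelian tensor square $G\otimes G$ is the group generated by symbols $g\otimes h$ ($g,h\in G$) subject to the relations $gg'\otimes h=({}^{g}g'\otimes {}^{g}h)(g\otimes h)$ and $g\otimes hh'=(g\otimes h)({}^{h}g\otimes {}^{h}h')$ for all $g,g',h,h'\in G$, where ${}^{g}x=gxg^{-1}$. Its identity is written $1$. Commutators are $[x,y]=xyx^{-1}y^{-1}$, iterated commutators are left-normed, $[x_1,\ldots,x_n]=[[x_1,\ldots,x_{n-1}],x_n]$, and $[x_1]=x_1$. For a subgroup $H$ of a finite group $G$ and $n\geq 1$, the relative $n$-tensor nilpotent degree of $H$ in $G$ is $$d_{n}^{\otimes}(H,G)=\frac{\left|\{(h_1,\ldots,h_n,g): h_i\in H,\ g\in G,\ [h_1,\ldots,h_n]\otimes g=1 \text{ in } G\otimes G\}\right|}{|H|^{n}|G|}.$$ *)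

theory Defs
  imports Complex_Main "HOL-Algebra.Coset"
begin

section \<open>Groups given by generators and relations\<close>

text \<open>A letter \<open>(x, True)\<close> stands for the generator \<open>x\<close> and \<open>(x, False)\<close> for its inverse.\<close>

type_synonym 'x gword = "('x \<times> bool) list"

definition gwords :: "'x set \<Rightarrow> 'x gword set" where
  "gwords X = lists (X \<times> UNIV)"

text \<open>\<open>(u, v) \<in> E\<close> is the relation \<open>u = v\<close>. Two words are related below iff they represent the same
  element of the group presented by \<open>\<langle>X | E\<rangle>\<close>.\<close>

inductive pres_eq :: "'x set \<Rightarrow> ('x gword \<times> 'x gword) set \<Rightarrow> 'x gword \<Rightarrow> 'x gword \<Rightarrow> bool"
  for X E where
  refl: "w \<in> gwords X \<Longrightarrow> pres_eq X E w w"
| sym: "pres_eq X E u v \<Longrightarrow> pres_eq X E v u"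
| trans: "pres_eq X E u v \<Longrightarrow> pres_eq X E v w \<Longrightarrow> pres_eq X E u w"
| append: "pres_eq X E u u' \<Longrightarrow> pres_eq X E v v' \<Longrightarrow> pres_eq X E (u @ v) (u' @ v')"
| cancel: "x \<in> X \<Longrightarrow> pres_eq X E [(x, b), (x, \<not> b)] []"
| rel: "(u, v) \<in> E \<Longrightarrow> u \<in> gwords X \<Longrightarrow> v \<in> gwords X \<Longrightarrow> pres_eq X E u v"

definition pres_class :: "'x set \<Rightarrow> ('x gword \<times> 'x gword) set \<Rightarrow> 'x gword \<Rightarrow> 'x gword set" where
  "pres_class X E w = {v. pres_eq X E w v}"

definition presented_group ::
  "'x set \<Rightarrow> ('x gword \<times> 'x gword) set \<Rightarrow> 'x gword set monoid" where
  "presented_group X E =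
    \<lparr>carrier = pres_class X E ` gwords X,
     mult = (\<lambda>A B. \<Union>a\<in>A. \<Union>b\<in>B. pres_class X E (a @ b)),
     one = pres_class X E []\<rparr>"

lemma gwords_simps [simp]:
  "[] \<in> gwords X"
  "(l # w) \<in> gwords X \<longleftrightarrow> fst l \<in> X \<and> w \<in> gwords X"
  "(u @ v) \<in> gwords X \<longleftrightarrow> u \<in> gwords X \<and> v \<in> gwords X"
  by (cases l; auto simp: gwords_def)+

lemma pres_eq_gwords: "pres_eq X E u v \<Longrightarrow> u \<in> gwords X \<and> v \<in> gwords X"
  by (induction rule: pres_eq.induct) auto

lemma pres_class_eq_iff:
  "u \<in> gwords X \<Longrightarrow> v \<in> gwords X \<Longrightarrow> pres_class X E u = pres_class X E v \<longleftrightarrow> pres_eq X E u v"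
  unfolding pres_class_def set_eq_iff mem_Collect_eq
  by (metis pres_eq.refl pres_eq.sym pres_eq.trans pres_eq_gwords)

lemma presented_group_mult:
  assumes "u \<in> gwords X" "v \<in> gwords X"
  shows "pres_class X E u \<otimes>\<^bsub>presented_group X E\<^esub> pres_class X E v = pres_class X E (u @ v)"
proof -
  have "pres_class X E (a @ b) = pres_class X E (u @ v)"
    if "a \<in> pres_class X E u" "b \<in> pres_class X E v" for a b
  proof -
    have "pres_eq X E (u @ v) (a @ b)"
      using that by (auto simp: pres_class_def intro: pres_eq.append)
    then show ?thesis
      by (metis pres_class_eq_iff pres_eq_gwords)
  qed
  moreover have "u \<in> pres_class X E u" "v \<in> pres_class X E v"
    using assms by (auto simp: pres_class_def intro: pres_eq.refl)
  ultimately have "(\<Union>a\<in>pres_class X E u. \<Union>b\<in>pres_class X E v. pres_class X E (a @ b)) =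
      pres_class X E (u @ v)"
    by blast
  then show ?thesis by (simp add: presented_group_def)
qed

lemma presented_group_carrier: "carrier (presented_group X E) = pres_class X E ` gwords X"
  by (simp add: presented_group_def)

lemma presented_group_one: "\<one>\<^bsub>presented_group X E\<^esub> = pres_class X E []"
  by (simp add: presented_group_def)

lemma pres_eq_inverse_word:
  assumes "w \<in> gwords X"
  shows "\<exists>v \<in> gwords X. pres_eq X E (v @ w) []"
  using assms
proof (induction w)
  case Nil
  show ?case by (rule bexI[of _ "[]"]) (auto intro: pres_eq.refl)
next
  case (Cons l w)
  obtain x b where l: "l = (x, b)" by (cases l)
  from Cons l obtain v where v: "v \<in> gwords X" "pres_eq X E (v @ w) []" and x: "x \<in> X" by auto
  have "pres_eq X E ([(x, \<not> b)] @ [(x, b)]) []"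
    using pres_eq.cancel[OF x, of E "\<not> b"] by simp
  then have "pres_eq X E ((v @ [(x, \<not> b), (x, b)]) @ w) ((v @ []) @ w)"
    using v Cons.prems by (intro pres_eq.append pres_eq.refl) auto
  from pres_eq.trans[OF this] v(2) l have "pres_eq X E ((v @ [(x, \<not> b)]) @ l # w) []"
    by simp
  then show ?case using v(1) x by (intro bexI[of _ "v @ [(x, \<not> b)]"]) auto
qed

lemma group_presented_group: "group (presented_group X E)"
proof (rule groupI)
  fix A assume "A \<in> carrier (presented_group X E)"
  then obtain w where w: "w \<in> gwords X" "A = pres_class X E w"
    by (auto simp: presented_group_carrier)
  obtain v where v: "v \<in> gwords X" "pres_eq X E (v @ w) []"
    using pres_eq_inverse_word[OF w(1)] by blast
  then show "\<exists>B\<in>carrier (presented_group X E). B \<otimes>\<^bsub>presented_group X E\<^esub> A = \<one>\<^bsub>presented_group X E\<^esub>"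
    using w by (intro bexI[of _ "pres_class X E v"])
      (auto simp: presented_group_carrier presented_group_mult presented_group_one
        pres_class_eq_iff)
next
  fix A B C
  assume "A \<in> carrier (presented_group X E)" "B \<in> carrier (presented_group X E)"
    "C \<in> carrier (presented_group X E)"
  then show "A \<otimes>\<^bsub>presented_group X E\<^esub> B \<otimes>\<^bsub>presented_group X E\<^esub> C =
      A \<otimes>\<^bsub>presented_group X E\<^esub> (B \<otimes>\<^bsub>presented_group X E\<^esub> C)"
    by (auto simp: presented_group_carrier presented_group_mult)
qed (auto simp: presented_group_carrier presented_group_mult presented_group_one)

primrec eval_word :: "('g, 'm) monoid_scheme \<Rightarrow> ('x \<Rightarrow> 'g) \<Rightarrow> 'x gword \<Rightarrow> 'g" where
  "eval_word T f [] = \<one>\<^bsub>T\<^esub>"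
| "eval_word T f (l # w) =
    (if snd l then f (fst l) else inv\<^bsub>T\<^esub> (f (fst l))) \<otimes>\<^bsub>T\<^esub> eval_word T f w"

lemma eval_word_closed:
  assumes "group T" "f \<in> X \<rightarrow> carrier T" "w \<in> gwords X"
  shows "eval_word T f w \<in> carrier T"
proof -
  interpret group T by fact
  show ?thesis using assms(2,3) by (induction w) auto
qed

lemma eval_word_append:
  assumes "group T" "f \<in> X \<rightarrow> carrier T" "u \<in> gwords X" "v \<in> gwords X"
  shows "eval_word T f (u @ v) = eval_word T f u \<otimes>\<^bsub>T\<^esub> eval_word T f v"
proof -
  interpret group T by fact
  show ?thesis using assms(3)
  proof (induction u)
    case Nil
    then show ?case using eval_word_closed[OF assms(1,2,4)] by simp
  next
    case (Cons l u)
    then have "f (fst l) \<in> carrier T" "u \<in> gwords X" using assms(2) by auto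
    with Cons.IH show ?case
      using eval_word_closed[OF assms(1,2)] assms(4) by (simp add: m_assoc)
  qed
qed

lemma pres_eq_eval_word:
  assumes "group T" "f \<in> X \<rightarrow> carrier T"
    and "\<And>u v. (u, v) \<in> E \<Longrightarrow> u \<in> gwords X \<Longrightarrow> v \<in> gwords X \<Longrightarrow> eval_word T f u = eval_word T f v"
    and "pres_eq X E u v"
  shows "eval_word T f u = eval_word T f v"
  using assms(4)
proof (induction rule: pres_eq.induct)
  case (append u u' v v')
  then show ?case by (metis eval_word_append[OF assms(1,2)] pres_eq_gwords)
next
  case (cancel x b)
  interpret group T by fact
  have "f x \<in> carrier T" using cancel assms(2) by auto
  then show ?case by (cases b) auto
next
  case (rel u v)
  then show ?case by (rule assms(3))
qed simp_all

text \<open>The universal property of the presentation.\<close>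

lemma presented_group_universal:
  assumes "group T" "f \<in> X \<rightarrow> carrier T"
    and "\<And>u v. (u, v) \<in> E \<Longrightarrow> u \<in> gwords X \<Longrightarrow> v \<in> gwords X \<Longrightarrow> eval_word T f u = eval_word T f v"
  shows "\<exists>\<phi> \<in> hom (presented_group X E) T. \<forall>x\<in>X. \<phi> (pres_class X E [(x, True)]) = f x"
proof -
  interpret group T by fact
  define \<phi> where "\<phi> A = eval_word T f (SOME w. w \<in> A)" for A
  have \<phi>: "\<phi> (pres_class X E w) = eval_word T f w" if "w \<in> gwords X" for w
  proof -
    have "pres_eq X E w (SOME v. v \<in> pres_class X E w)"
      using someI[of "\<lambda>v. v \<in> pres_class X E w" w] that pres_eq.refl[of w X E]
      by (simp add: pres_class_def)
    from pres_eq_eval_word[OF assms this] show ?thesis by (simp add: \<phi>_def)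
  qed
  have "\<phi> \<in> hom (presented_group X E) T"
    by (rule homI) (auto simp: presented_group_carrier \<phi> presented_group_mult eval_word_closed[OF assms(1,2)]
        eval_word_append[OF assms(1,2)])
  moreover have "\<phi> (pres_class X E [(x, True)]) = f x" if "x \<in> X" for x
    using that \<phi>[of "[(x, True)]"] assms(2) by (auto simp: Pi_iff)
  ultimately show ?thesis by blast
qed

section \<open>The nonabelian tensor square\<close>

definition conj_act :: "('a, 'm) monoid_scheme \<Rightarrow> 'a \<Rightarrow> 'a \<Rightarrow> 'a" where
  "conj_act G g x = g \<otimes>\<^bsub>G\<^esub> x \<otimes>\<^bsub>G\<^esub> inv\<^bsub>G\<^esub> g"

definition tensor_rels ::
  "('a, 'm) monoid_scheme \<Rightarrow> (('a \<times> 'a) gword \<times> ('a \<times> 'a) gword) set" where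
  "tensor_rels G =
    {([((g \<otimes>\<^bsub>G\<^esub> g', h), True)],
      [((conj_act G g g', conj_act G g h), True), ((g, h), True)]) | g g' h.
        g \<in> carrier G \<and> g' \<in> carrier G \<and> h \<in> carrier G} \<union>
    {([((g, h \<otimes>\<^bsub>G\<^esub> h'), True)],
      [((g, h), True), ((conj_act G h g, conj_act G h h'), True)]) | g h h'.
        g \<in> carrier G \<and> h \<in> carrier G \<and> h' \<in> carrier G}"

definition tensor_square :: "('a, 'm) monoid_scheme \<Rightarrow> ('a \<times> 'a) gword set monoid" where
  "tensor_square G = presented_group (carrier G \<times> carrier G) (tensor_rels G)"

definition tensor :: "('a, 'm) monoid_scheme \<Rightarrow> 'a \<Rightarrow> 'a \<Rightarrow> ('a \<times> 'a) gword set" where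
  "tensor G g h = pres_class (carrier G \<times> carrier G) (tensor_rels G) [((g, h), True)]"

lemma group_tensor_square: "group (tensor_square G)"
  by (simp add: tensor_square_def group_presented_group)

lemma tensor_closed:
  "g \<in> carrier G \<Longrightarrow> h \<in> carrier G \<Longrightarrow> tensor G g h \<in> carrier (tensor_square G)"
  by (auto simp: tensor_square_def tensor_def presented_group_def)

lemma tensor_mult_left:
  assumes "group G" "g \<in> carrier G" "g' \<in> carrier G" "h \<in> carrier G"
  shows "tensor G (g \<otimes>\<^bsub>G\<^esub> g') h =
    tensor G (conj_act G g g') (conj_act G g h) \<otimes>\<^bsub>tensor_square G\<^esub> tensor G g h"
proof -
  interpret group G by fact
  have "([((g \<otimes>\<^bsub>G\<^esub> g', h), True)],
      [((conj_act G g g', conj_act G g h), True), ((g, h), True)]) \<in> tensor_rels G"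
    using assms(2-) unfolding tensor_rels_def by blast
  from pres_eq.rel[OF this, of "carrier G \<times> carrier G"] show ?thesis
    using assms(2-)
    by (simp add: tensor_def tensor_square_def presented_group_mult conj_act_def pres_class_eq_iff)
qed

lemma tensor_mult_right:
  assumes "group G" "g \<in> carrier G" "h \<in> carrier G" "h' \<in> carrier G"
  shows "tensor G g (h \<otimes>\<^bsub>G\<^esub> h') =
    tensor G g h \<otimes>\<^bsub>tensor_square G\<^esub> tensor G (conj_act G h g) (conj_act G h h')"
proof -
  interpret group G by fact
  have "([((g, h \<otimes>\<^bsub>G\<^esub> h'), True)],
      [((g, h), True), ((conj_act G h g, conj_act G h h'), True)]) \<in> tensor_rels G"
    using assms(2-) unfolding tensor_rels_def by blast
  from pres_eq.rel[OF this, of "carrier G \<times> carrier G"] show ?thesis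
    using assms(2-)
    by (simp add: tensor_def tensor_square_def presented_group_mult conj_act_def pres_class_eq_iff)
qed

section \<open>The relative tensor nilpotent degree\<close>

definition commutator :: "('a, 'm) monoid_scheme \<Rightarrow> 'a \<Rightarrow> 'a \<Rightarrow> 'a" where
  "commutator G x y = x \<otimes>\<^bsub>G\<^esub> y \<otimes>\<^bsub>G\<^esub> inv\<^bsub>G\<^esub> x \<otimes>\<^bsub>G\<^esub> inv\<^bsub>G\<^esub> y"

text \<open>The value at the empty list is a convention and plays no role for degrees \<open>n \<ge> 1\<close>.\<close>

fun iter_commutator :: "('a, 'm) monoid_scheme \<Rightarrow> 'a list \<Rightarrow> 'a" where
  "iter_commutator G [] = \<one>\<^bsub>G\<^esub>"
| "iter_commutator G (x # xs) = foldl (commutator G) x xs"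

lemma iter_commutator_singleton: "iter_commutator G [x] = x"
  by simp

lemma iter_commutator_snoc:
  "xs \<noteq> [] \<Longrightarrow> iter_commutator G (xs @ [y]) = commutator G (iter_commutator G xs) y"
  by (cases xs) auto

definition tensor_nil_degree :: "nat \<Rightarrow> 'a set \<Rightarrow> ('a, 'm) monoid_scheme \<Rightarrow> real" where
  "tensor_nil_degree n H G =
    real (card {(hs, g). length hs = n \<and> set hs \<subseteq> H \<and> g \<in> carrier G \<and>
                  tensor G (iter_commutator G hs) g = \<one>\<^bsub>tensor_square G\<^esub>})
    / (real (card H) ^ n * real (card (carrier G)))"

end

theory Submission
  imports Defs
begin

text \<open>A homomorphism \<open>G \<rightarrow> K\<close> induces a homomorphism of tensor squares, so reduction modulo \<open>N\<close> sends
  the tuples counted for \<open>(H, G)\<close> to tuples counted for \<open>(H/N, G/N)\<close>. A tuple of \<open>n + 1\<close> cosets has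
  \<open>|N|\<^sup>n\<^sup>+\<^sup>1\<close> lifts, which is exactly the ratio of the denominators.\<close>

context group_hom
begin

lemma hom_conj_act:
  "g \<in> carrier G \<Longrightarrow> x \<in> carrier G \<Longrightarrow> h (conj_act G g x) = conj_act H (h g) (h x)"
  by (simp add: conj_act_def)

lemma hom_commutator:
  "x \<in> carrier G \<Longrightarrow> y \<in> carrier G \<Longrightarrow> h (commutator G x y) = commutator H (h x) (h y)"
  by (simp add: commutator_def)

text \<open>Left-normed commutators grow at the right end, hence the induction from the right.
  Closure is proved jointly because \<open>hom_commutator\<close> needs the inner commutator to lie
  in the carrier.\<close>

lemma hom_iter_commutator:
  assumes "set xs \<subseteq> carrier G"
  shows "iter_commutator G xs \<in> carrier G \<and>
    h (iter_commutator G xs) = iter_commutator H (map h xs)"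
  using assms
proof (induction xs rule: rev_induct)
  case (snoc y xs)
  show ?case
  proof (cases "xs = []")
    case False
    have "commutator G (iter_commutator G xs) y \<in> carrier G"
      using snoc by (simp add: commutator_def)
    with snoc False show ?thesis
      by (simp add: iter_commutator_snoc hom_commutator)
  qed (use snoc in simp)
qed simp

text \<open>By the universal property of the presentation it suffices that the images of the
  generators satisfy both families of defining relations. They do, since \<open>h\<close> respects
  products and conjugation and the same relations hold in the tensor square of
  \<open>H\<close>.\<close>

lemma tensor_square_map:
  "\<exists>\<phi> \<in> hom (tensor_square G) (tensor_square H).
    \<forall>a\<in>carrier G. \<forall>b\<in>carrier G. \<phi> (tensor G a b) = tensor H (h a) (h b)"
proof -
  let ?f = "\<lambda>(a, b). tensor H (h a) (h b)"
  interpret T: group "tensor_square H" by (rule group_tensor_square)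
  have "eval_word (tensor_square H) ?f u = eval_word (tensor_square H) ?f v"
    if "(u, v) \<in> tensor_rels G" for u v
  proof -
    \<comment> \<open>Evaluating a word leaves a trailing factor \<open>\<one>\<close>, which is
      absorbed once the last tensor is known to lie in the carrier. In the second family of
      relations that tensor is one of conjugates.\<close>
    have conj: "conj_act H (h a) (h b) \<in> carrier H" if "a \<in> carrier G" "b \<in> carrier G" for a b
      using that by (simp add: conj_act_def)
    from that show ?thesis
      by (auto simp: tensor_rels_def hom_conj_act conj tensor_closed
          tensor_mult_left[OF H.is_group] tensor_mult_right[OF H.is_group])
  qed
  then have "\<exists>\<phi> \<in> hom (tensor_square G) (tensor_square H).
      \<forall>x\<in>carrier G \<times> carrier G.
        \<phi> (pres_class (carrier G \<times> carrier G) (tensor_rels G) [(x, True)]) = ?f x"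
    unfolding tensor_square_def[of G]
    by (intro presented_group_universal group_tensor_square) (auto simp: tensor_closed)
  then show ?thesis
    by (auto simp: tensor_def)
qed

lemma tensor_eq_one_hom:
  assumes "a \<in> carrier G" "b \<in> carrier G" "tensor G a b = \<one>\<^bsub>tensor_square G\<^esub>"
  shows "tensor H (h a) (h b) = \<one>\<^bsub>tensor_square H\<^esub>"
  using tensor_square_map assms Group.hom_one[OF _ group_tensor_square group_tensor_square] by metis

end

text \<open>For a list of cosets, \<open>listset\<close> is the set of its lifts; this form reduces
  membership to a check entry by entry.\<close>

lemma listset_eq_list_all2: "listset As = {xs. list_all2 (\<in>) xs As}"
  by (induction As) (auto simp: set_Cons_def list_all2_Cons2)

text \<open>Presents \<open>listset\<close> as an injective image of a Cartesian product, so that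
  finiteness and cardinality follow by induction.\<close>

lemma listset_Cons_image: "listset (A # As) = (\<lambda>(x, xs). x # xs) ` (A \<times> listset As)"
  by (auto simp: set_Cons_def)

lemma card_listset_const:
  assumes "\<And>A. A \<in> set As \<Longrightarrow> card A = c"
  shows "card (listset As) = c ^ length As"
  using assms
proof (induction As)
  case (Cons A As)
  have "inj_on (\<lambda>(x, xs). x # xs) (A \<times> listset As)"
    by (auto simp: inj_on_def)
  then show ?case
    using Cons by (simp add: listset_Cons_image card_image card_cartesian_product del: listset.simps(2))
qed simp

lemma finite_listset:
  "(\<And>A. A \<in> set As \<Longrightarrow> finite A) \<Longrightarrow> finite (listset As)"
  by (induction As) (simp_all add: listset_Cons_image del: listset.simps(2))

theorem theorem3p7:
  fixes G :: "('a, 'm) monoid_scheme" and H N :: "'a set" and n :: nat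
  assumes "group G" and "finite (carrier G)"
    and "subgroup H G" and "N \<lhd> G" and "N \<subseteq> H"
    and "n \<ge> 1"
  shows "tensor_nil_degree n H G \<le>
    tensor_nil_degree n (carrier ((G\<lparr>carrier := H\<rparr>) Mod N)) (G Mod N)"
proof -
  interpret G: group G by fact
  interpret N: normal N G by fact
  interpret Hs: subgroup H G by fact
  interpret p: group_hom G "G Mod N" "\<lambda>a. N #>\<^bsub>G\<^esub> a"
    by (intro group_hom.intro group_hom_axioms.intro N.factorgroup_is_group N.r_coset_hom_Mod
        G.is_group)
  let ?HN = "carrier ((G\<lparr>carrier := H\<rparr>) Mod N)"
  define S where "S = {(hs, g). length hs = n \<and> set hs \<subseteq> H \<and> g \<in> carrier G \<and>
    tensor G (iter_commutator G hs) g = \<one>\<^bsub>tensor_square G\<^esub>}"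
  define S' where "S' = {(hs, g). length hs = n \<and> set hs \<subseteq> ?HN \<and> g \<in> carrier (G Mod N) \<and>
    tensor (G Mod N) (iter_commutator (G Mod N) hs) g = \<one>\<^bsub>tensor_square (G Mod N)\<^esub>}"
  \<comment> \<open>Restricting the carrier to \<open>H\<close> leaves multiplication unchanged, so
    the cosets formed inside \<open>H\<close> are cosets in \<open>G\<close>.\<close>
  have HN: "?HN = (\<lambda>a. N #>\<^bsub>G\<^esub> a) ` H"
    by (auto simp: FactGroup_def RCOSETS_def r_coset_def)
  have GN: "carrier (G Mod N) = rcosets\<^bsub>G\<^esub> N"
    by (simp add: FactGroup_def)
  have H_sub: "H \<subseteq> carrier G" by (rule Hs.subset)
  have HN_sub: "?HN \<subseteq> rcosets\<^bsub>G\<^esub> N"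
    using H_sub by (auto simp: HN RCOSETS_def)
  have fin: "finite (rcosets\<^bsub>G\<^esub> N)" "finite H" "finite N"
    using assms(2,5) H_sub by (auto simp: RCOSETS_def intro: finite_subset)
  have coset: "finite C \<and> card C = card N" if "C \<in> rcosets\<^bsub>G\<^esub> N" for C
    using that assms(2) G.card_rcosets_equal[OF that N.subset] G.rcosets_part_G[OF N.is_subgroup]
    by (auto intro: finite_subset)
  have orderG: "card (carrier G) = card N * card (carrier (G Mod N))"
    using G.lagrange[OF N.is_subgroup] by (simp add: GN order_def mult.commute)
  \<comment> \<open>Lagrange's theorem inside \<open>H\<close>, where \<open>N\<close> is a subgroup
    because \<open>N \<subseteq> H\<close>.\<close>
  have orderH: "card H = card N * card ?HN"
    using group.lagrange[OF Hs.subgroup_is_group[OF G.is_group], of N]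
      G.subgroup_incl[OF N.is_subgroup assms(3,5)]
    by (simp add: FactGroup_def order_def mult.commute)
  have N_pos: "card N > 0"
    using fin(3) N.one_closed card_gt_0_iff by blast
  \<comment> \<open>With finite fibres this makes the union over \<open>S'\<close> finite, as
    monotonicity of \<open>card\<close> requires.\<close>
  have finS': "finite S'"
  proof (rule finite_subset)
    show "S' \<subseteq> {xs. set xs \<subseteq> ?HN \<and> length xs = n} \<times> carrier (G Mod N)"
      by (auto simp: S'_def)
    show "finite ({xs. set xs \<subseteq> ?HN \<and> length xs = n} \<times> carrier (G Mod N))"
      using fin HN_sub by (auto simp: GN intro!: finite_lists_length_eq intro: finite_subset)
  qed
  \<comment> \<open>The exponent \<open>Suc n\<close> counts the \<open>n\<close> cosets in
    \<open>Cs\<close> and the coset \<open>C\<close>.\<close>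
  have lifts: "finite (listset Cs \<times> C) \<and> card (listset Cs \<times> C) = card N ^ Suc n"
    if "(Cs, C) \<in> S'" for Cs C
  proof -
    have "\<And>A. A \<in> set Cs \<Longrightarrow> A \<in> rcosets\<^bsub>G\<^esub> N" "C \<in> rcosets\<^bsub>G\<^esub> N" "length Cs = n"
      using that HN_sub by (auto simp: S'_def GN)
    then show ?thesis
      using coset card_listset_const[of Cs "card N"] finite_listset[of Cs]
      by (simp add: card_cartesian_product)
  qed
  \<comment> \<open>Every tuple in \<open>S\<close> lifts its own reduction modulo \<open>N\<close>,
    since each element lies in its own coset.\<close>
  have "S \<subseteq> (\<Union>(Cs, C)\<in>S'. listset Cs \<times> C)"
  proof clarify
    fix hs g assume hg: "(hs, g) \<in> S"
    then have hs: "set hs \<subseteq> carrier G" "g \<in> carrier G" using H_sub by (auto simp: S_def)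
    let ?Cs = "map (\<lambda>a. N #>\<^bsub>G\<^esub> a) hs" and ?C = "N #>\<^bsub>G\<^esub> g"
    have "(?Cs, ?C) \<in> S'"
      using hg p.tensor_eq_one_hom[of "iter_commutator G hs" g] p.hom_iter_commutator[OF hs(1)]
        p.hom_closed[OF hs(2)]
      by (auto simp: S_def S'_def HN)
    moreover have "hs \<in> listset ?Cs"
      using hs G.rcos_self[OF _ N.is_subgroup]
      by (auto simp: listset_eq_list_all2 list_all2_conv_all_nth dest!: nth_mem)
    moreover have "g \<in> ?C" using G.rcos_self[OF hs(2) N.is_subgroup] .
    ultimately show "(hs, g) \<in> (\<Union>(Cs, C)\<in>S'. listset Cs \<times> C)" by blast
  qed
  then have "card S \<le> card (\<Union>(Cs, C)\<in>S'. listset Cs \<times> C)"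
    using finS' lifts by (intro card_mono finite_UN_I) auto
  also have "\<dots> \<le> (\<Sum>(Cs, C)\<in>S'. card (listset Cs \<times> C))"
    using card_UN_le[OF finS', of "\<lambda>(Cs, C). listset Cs \<times> C"] by (simp add: case_prod_unfold)
  also have "\<dots> = card N ^ Suc n * card S'"
    using lifts by (simp add: case_prod_unfold)
  finally have "real (card S) \<le> real (card N) ^ Suc n * real (card S')"
    by (metis of_nat_le_iff of_nat_mult of_nat_power)
  then have "real (card S) / (real (card H) ^ n * real (card (carrier G))) \<le>
      (real (card N) ^ Suc n * real (card S')) / (real (card H) ^ n * real (card (carrier G)))"
    by (rule divide_right_mono) simp
  \<comment> \<open>By \<open>orderH\<close> and \<open>orderG\<close> the denominator contains
    \<open>card N\<close> exactly \<open>n + 1\<close> times, and this nonzero power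
    cancels.\<close>
  also have "\<dots> = real (card S') / (real (card ?HN) ^ n * real (card (carrier (G Mod N))))"
    using N_pos by (simp add: orderG orderH power_mult_distrib)
  finally show ?thesis
    unfolding tensor_nil_degree_def S_def S'_def .
qed

end
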